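(* Let $n,p,q,l\ge1$ be integers, let $\bar A\in\mathbb{R}^{n\times n}$, $\bar B\in\mathbb{R}^{n\times p}$, $\bar G'\in\mathbb{R}^{l\times n}$, $\bar H'\in\mathbb{R}^{l\times p}$, $\Pi\in\mathbb{R}^{q\times l}$, and put $\bar G=\Pi\bar G'$, $\bar H=\Pi\bar H'$. With $\bar D(\cdot)$ and $F$ as in the context, assume that $\bar D(\zeta)$ has full row rank for every $\zeta\in\mathbb{C}$. Fix any $z\in\mathbb{C}$ and an integer $\rho\ge1$, and consider the problem $$(\ast)\qquad \min_{K\in\mathbb{R}^{(p+l)\times(n+p)}}\ \big\|[\bar H,\Pi]K\big\|_2\quad\text{s.t.}\quad \mathrm{rank}(\bar D(z)+FK)<\rho .$$ Let $\bar D(z)^\dagger F=\sum_{\ell=1}^{\mathrm{rank}(F)}\sigma_\ell(z)u_\ell(z)v_\ell(z)^T$ be the singular value decomposition of $\bar D(z)^\dagger F$ described in the context. Then: (i) Problem $(\ast)$ is feasible if and only if $\rho\ge n+q-\mathrm{rank}(F)+1$. (ii) If $\rho>n+q$, then $\tilde K=\mathbf{0}_{(p+l)\times(n+p)}$ is an optimal solution of $(\ast)$ and the optimal value of $(\ast)$ is zero. (iii) If $n+q-\mathrm{rank}(F)+1\le\rho\le n+q$, then $$\tilde K(z)=-\sum_{\ell=1}^{n+q-\rho+1}\frac{1}{\sigma_\ell(z)}\,v_\ell(z)u_\ell(z)^T$$ is a feasible solution of $(\ast)$, and the optimal value of $(\ast)$ is upper bounded by $\|[\bar H,\Pi]\|_2\,\|(\bar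 D(z)^\dagger F)^\dagger\|_*$.
   Context: $M^\dagger$ is the pseudoinverse, $\|\cdot\|_2$ the induced $\ell_2$ (spectral) norm, and $\|\cdot\|_*$ the nuclear norm (sum of singular values). For $\zeta\in\mathbb{C}$, $$\bar D(\zeta)=\begin{bmatrix} \zeta I_n-\bar A&-\bar B\\ \bar G&\bar H\end{bmatrix}\in\mathbb{C}^{(n+q)\times(n+p)},\qquad F=\begin{bmatrix}-\bar B&\mathbf{0}_{n\times l}\\ \bar H&\Pi\end{bmatrix}\in\mathbb{R}^{(n+q)\times(p+l)}.$$ Singular value decomposition: $\bar D(z)^\dagger F=U(z)\Sigma(z)V(z)^T$, where $U(z)$, of size $(n+p)\times(n+p)$, and $V(z)$, of size $(p+l)\times(p+l)$, are unitary with $\ell$-th columns $u_\ell(z)$ and $v_\ell(z)$ respectively, and $\sigma_\ell(z)$ is the $\ell$-th diagonal entry of $\Sigma(z)$, arranged in descending order. Since $\bar D(z)$ has full row rank, $\mathrm{rank}(\bar D(z)^\dagger F)=\mathrm{rank}(F)$, so $\sigma_1(z)\ge\cdots\ge\sigma_{\mathrm{rank}(F)}(z)>0$ and the remaining diagonal entries are $0$.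
   Formalization: For nonreal z and real K, (i) "if" and (iii) can fail. They are stated for complex K at any z, or for real K at real z (with real u_ℓ, v_ℓ for feasibility of the matrix K̃(z)); (i) "only if" and (ii) hold at all z for both. The superscript T is read as conjugate transpose. *)

theory Defs
  imports "HOL-Analysis.Analysis"
begin

text \<open>
  An \<open>a \<times> b\<close> matrix has type \<open>_ ^ 'b ^ 'a\<close>; block rows and columns are indexed by sum types,
  so that an \<open>(n+q) \<times> (n+p)\<close> matrix has type \<open>_ ^ ('n + 'p) ^ ('n + 'q)\<close>.
\<close>

definition hcat :: "'a ^ 'b ^ 'r \<Rightarrow> 'a ^ 'c ^ 'r \<Rightarrow> 'a ^ ('b + 'c) ^ 'r" where
  "hcat X Y = (\<chi> i j. case j of Inl b \<Rightarrow> X $ i $ b | Inr c \<Rightarrow> Y $ i $ c)"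

definition vcat :: "'a ^ 'c ^ 'r \<Rightarrow> 'a ^ 'c ^ 's \<Rightarrow> 'a ^ 'c ^ ('r + 's)" where
  "vcat X Y = (\<chi> i. case i of Inl r \<Rightarrow> X $ r | Inr s \<Rightarrow> Y $ s)"

definition cmat :: "real ^ 'c ^ 'r \<Rightarrow> complex ^ 'c ^ 'r" where
  "cmat M = (\<chi> i j. complex_of_real (M $ i $ j))"

definition D_bar :: "real ^ 'n ^ 'n \<Rightarrow> real ^ 'p ^ 'n \<Rightarrow> real ^ 'n ^ 'q \<Rightarrow> real ^ 'p ^ 'q
    \<Rightarrow> complex \<Rightarrow> complex ^ ('n + 'p) ^ ('n + 'q)" where
  "D_bar A B G H \<zeta> = vcat (hcat (mat \<zeta> - cmat A) (- cmat B)) (hcat (cmat G) (cmat H))"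

definition F_mat :: "real ^ 'p ^ 'n \<Rightarrow> real ^ 'p ^ 'q \<Rightarrow> real ^ 'l ^ 'q
    \<Rightarrow> real ^ ('p + 'l) ^ ('n + 'q)" where
  "F_mat B H P = vcat (hcat (- B) 0) (hcat H P)"

definition ctranspose :: "complex ^ 'c ^ 'r \<Rightarrow> complex ^ 'r ^ 'c" where
  "ctranspose M = (\<chi> i j. cnj (M $ j $ i))"

text \<open>The Moore--Penrose pseudoinverse, by the four Penrose conditions.\<close>

definition is_pinv :: "complex ^ 'c ^ 'r \<Rightarrow> complex ^ 'r ^ 'c \<Rightarrow> bool" where
  "is_pinv M X \<longleftrightarrow> M ** X ** M = M \<and> X ** M ** X = X \<and>
     ctranspose (M ** X) = M ** X \<and> ctranspose (X ** M) = X ** M"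

definition pinv :: "complex ^ 'c ^ 'r \<Rightarrow> complex ^ 'r ^ 'c" where
  "pinv M = (THE X. is_pinv M X)"

definition spectral_norm :: "complex ^ 'c ^ 'r \<Rightarrow> real" where
  "spectral_norm M = onorm (\<lambda>x. M *v x)"

text \<open>
  \<open>s > 0\<close> is a singular value of \<open>M\<close> iff \<open>s\<^sup>2\<close> is an eigenvalue of \<open>M\<^sup>* M\<close>, and its multiplicity
  is the dimension of the eigenspace. (Zero singular values do not contribute to the nuclear norm.)
\<close>

definition sv_mult :: "complex ^ 'c ^ 'r \<Rightarrow> real \<Rightarrow> nat" where
  "sv_mult M s = vec.dim {x. (ctranspose M ** M) *v x = complex_of_real (s\<^sup>2) *s x}"

definition nuclear_norm :: "complex ^ 'c ^ 'r \<Rightarrow> real" where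
  "nuclear_norm M = (\<Sum>s | s > 0 \<and> sv_mult M s > 0. real (sv_mult M s) * s)"

definition outer :: "complex ^ 'r \<Rightarrow> complex ^ 'c \<Rightarrow> complex ^ 'c ^ 'r" where
  "outer x y = (\<chi> i j. x $ i * cnj (y $ j))"

definition orthonormal_family :: "nat \<Rightarrow> (nat \<Rightarrow> complex ^ 'd) \<Rightarrow> bool" where
  "orthonormal_family m w \<longleftrightarrow>
     (\<forall>i\<in>{1..m}. \<forall>j\<in>{1..m}. (\<Sum>k\<in>UNIV. cnj (w i $ k) * w j $ k) = (if i = j then 1 else 0))"

text \<open>
  The full decomposition \<open>M = U \<Sigma> V\<^sup>*\<close>, with \<open>u 1, u 2, \<dots>\<close> and \<open>v 1, v 2, \<dots>\<close> the columns of the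
  unitary matrices \<open>U\<close> and \<open>V\<close>, and \<open>\<sigma> 1 \<ge> \<sigma> 2 \<ge> \<dots>\<close> the diagonal entries of the rectangular
  matrix \<open>\<Sigma>\<close>. Over the complex numbers the adjoint is the conjugate transpose, also within \<open>outer\<close>.
\<close>

definition is_svd :: "complex ^ 'c ^ 'r \<Rightarrow> (nat \<Rightarrow> complex ^ 'r) \<Rightarrow> (nat \<Rightarrow> real)
    \<Rightarrow> (nat \<Rightarrow> complex ^ 'c) \<Rightarrow> bool" where
  "is_svd M u \<sigma> v \<longleftrightarrow>
     orthonormal_family CARD('r) u \<and> orthonormal_family CARD('c) v \<and>
     (\<forall>i\<in>{1..min CARD('r) CARD('c)}. \<sigma> i \<ge> 0) \<and>
     (\<forall>i\<in>{1..min CARD('r) CARD('c)}. \<forall>j\<in>{1..min CARD('r) CARD('c)}. i \<le> j \<longrightarrow> \<sigma> j \<le> \<sigma> i) \<and>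
     M = (\<Sum>i = 1..min CARD('r) CARD('c). \<sigma> i *\<^sub>R outer (u i) (v i))"

text \<open>
  The problem of minimising \<open>\<parallel>W K\<parallel>\<close> subject to \<open>rank (D + F K) < \<rho>\<close>, over the matrices \<open>K\<close>
  with entries in \<open>S\<close> (the real or the complex numbers).
\<close>

definition feasible_set :: "complex set \<Rightarrow> complex ^ 'c ^ 'r \<Rightarrow> complex ^ 'm ^ 'r \<Rightarrow> nat
    \<Rightarrow> (complex ^ 'c ^ 'm) set" where
  "feasible_set S D F \<rho> = {K. (\<forall>i j. K $ i $ j \<in> S) \<and> rank (D + F ** K) < \<rho>}"

definition objective :: "complex ^ 'm ^ 'k \<Rightarrow> complex ^ 'c ^ 'm \<Rightarrow> real" where
  "objective W K = spectral_norm (W ** K)"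

definition is_optimal_solution :: "complex set \<Rightarrow> complex ^ 'm ^ 'k \<Rightarrow> complex ^ 'c ^ 'r
    \<Rightarrow> complex ^ 'm ^ 'r \<Rightarrow> nat \<Rightarrow> complex ^ 'c ^ 'm \<Rightarrow> bool" where
  "is_optimal_solution S W D F \<rho> K \<longleftrightarrow>
     K \<in> feasible_set S D F \<rho> \<and> (\<forall>K'\<in>feasible_set S D F \<rho>. objective W K \<le> objective W K')"

text \<open>Extended-real valued, so that an infeasible problem has optimal value \<open>\<infinity>\<close>.\<close>

definition optimal_value :: "complex set \<Rightarrow> complex ^ 'm ^ 'k \<Rightarrow> complex ^ 'c ^ 'r
    \<Rightarrow> complex ^ 'm ^ 'r \<Rightarrow> nat \<Rightarrow> ereal" where
  "optimal_value S W D F \<rho> = (INF K\<in>feasible_set S D F \<rho>. ereal (objective W K))"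

definition K_tilde :: "(nat \<Rightarrow> complex ^ 'c) \<Rightarrow> (nat \<Rightarrow> real) \<Rightarrow> (nat \<Rightarrow> complex ^ 'm) \<Rightarrow> nat
    \<Rightarrow> complex ^ 'c ^ 'm" where
  "K_tilde u \<sigma> v k = - (\<Sum>i = 1..k. (1 / \<sigma> i) *\<^sub>R outer (v i) (u i))"

end

theory Submission
  imports Defs
begin

text \<open>
  Let \<open>D\<^sup>+\<close> be the pseudoinverse of \<open>D = D(z)\<close> and \<open>M = D\<^sup>+ F\<close>. Full row rank gives \<open>D D\<^sup>+ = I\<close>, hence
  \<open>F = D M\<close> and \<open>rank M = rank F\<close>. For \<open>K\<close> minus the sum of \<open>k \<le> rank F\<close>
  inverted singular terms, \<open>- M K\<close> is the orthogonal projection onto \<open>k\<close> left singular vectors of \<open>M\<close>, which all lie in the range of \<open>D\<^sup>+\<close>, so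
  that \<open>D + F K\<close> has rank at most \<open>N - k\<close>. Conversely \<open>F K\<close> can lower the rank by at most \<open>rank F\<close>.
  The choice \<open>K = - M\<^sup>+\<close>, which is real whenever \<open>z\<close> is, is feasible whenever the problem is;
  the bound follows because the spectral norm of \<open>M\<^sup>+\<close> is at most its nuclear norm.
\<close>

section \<open>Rank over a field\<close>

text \<open>Expanding the rows in a basis \<open>B\<close> of the row space gives one coefficient
  vector per basis element, and these vectors span the columns. Applied to \<open>A\<close> and
  \<open>transpose A\<close>, this equates row and column rank over any field.\<close>

lemma dim_columns_le_dim_rows:
  fixes A :: "'a::field^'n^'m"
  shows "vec.dim (columns A) \<le> vec.dim (rows A)"
proof -
  obtain B where B: "B \<subseteq> rows A" "vec.independent B" "rows A \<subseteq> vec.span B"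
      "card B = vec.dim (rows A)"
    using vec.basis_exists by blast
  have fin: "finite B"
    using B(2) by (rule vec.finiteI_independent)
  have "\<exists>c. row i A = (\<Sum>b\<in>B. c b *s b)" for i
  proof -
    have "row i A \<in> vec.span B"
      using B(3) by (auto simp: rows_def)
    then show ?thesis
      by (auto simp: vec.span_finite[OF fin])
  qed
  then obtain c where c: "\<And>i. row i A = (\<Sum>b\<in>B. c i b *s b)"
    by metis
  have "columns A \<subseteq> vec.span ((\<lambda>b. \<chi> i. c i b) ` B)"
  proof
    fix y assume "y \<in> columns A"
    then obtain j where y: "y = column j A"
      by (auto simp: columns_def)
    have "y = (\<Sum>b\<in>B. b $ j *s (\<chi> i. c i b))"
    proof (subst vec_eq_iff, rule allI)
      fix i
      have "y $ i = row i A $ j"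
        by (simp add: y column_def row_def)
      also have "\<dots> = (\<Sum>b\<in>B. b $ j *s (\<chi> i. c i b)) $ i"
        by (simp add: c mult.commute)
      finally show "y $ i = (\<Sum>b\<in>B. b $ j *s (\<chi> i. c i b)) $ i" .
    qed
    also have "\<dots> \<in> vec.span ((\<lambda>b. \<chi> i. c i b) ` B)"
      by (intro vec.span_sum vec.span_scale vec.span_base imageI)
    finally show "y \<in> vec.span ((\<lambda>b. \<chi> i. c i b) ` B)" .
  qed
  then have "vec.dim (columns A) \<le> card ((\<lambda>b. \<chi> i. c i b) ` B)"
    by (intro vec.dim_le_card) (auto simp: fin)
  also have "\<dots> \<le> card B"
    by (rule card_image_le[OF fin])
  finally show ?thesis
    using B(4) by simp
qed

lemma rank_eq_dim_columns:
  fixes A :: "'a::field^'n^'m"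
  shows "rank A = vec.dim (columns A)"
  using dim_columns_le_dim_rows[of A] dim_columns_le_dim_rows[of "transpose A"]
  by (simp add: row_rank_def_gen)

lemma rank_eq_dim_range:
  fixes A :: "'a::field^'n^'m"
  shows "rank A = vec.dim (range ((*v) A))"
proof (rule antisym)
  have "columns A \<subseteq> range ((*v) A)"
  proof
    fix y assume "y \<in> columns A"
    then obtain j where "y = column j A"
      by (auto simp: columns_def)
    then have "y = A *v axis j 1"
      by (simp add: vec_eq_iff column_def matrix_vector_mult_def axis_def if_distrib cong: if_cong)
    then show "y \<in> range ((*v) A)"
      by simp
  qed
  then show "rank A \<le> vec.dim (range ((*v) A))"
    unfolding rank_eq_dim_columns by (rule vec.dim_subset)
  have "range ((*v) A) \<subseteq> vec.span (columns A)"
    using matrix_vector_mult_in_columnspace_gen by blast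
  then show "vec.dim (range ((*v) A)) \<le> rank A"
    unfolding rank_eq_dim_columns by (metis vec.dim_span vec.dim_subset)
qed

lemma surj_if_full_row_rank:
  fixes A :: "'a::field^'n^'m"
  assumes "rank A = CARD('m)"
  shows "surj ((*v) A)"
proof -
  have "vec.subspace (range ((*v) A))"
    by (intro vec.subspace_image) simp
  then show ?thesis
    using assms unfolding rank_eq_dim_range
    by (metis vec.span_eq_iff vec.dim_eq_full vec_dim_card vec.dim_UNIV vec.dimension_def)
qed

lemma rank_mult_le_left:
  fixes A :: "'a::field^'n^'m" and B :: "'a^'k^'n"
  shows "rank (A ** B) \<le> rank A"
  unfolding rank_eq_dim_range
  by (rule vec.dim_subset) (auto simp flip: matrix_vector_mul_assoc)

lemma rank_mult_le_right:
  fixes A :: "'a::field^'n^'m" and B :: "'a^'k^'n"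
  shows "rank (A ** B) \<le> rank B"
proof -
  have "range ((*v) (A ** B)) = (*v) A ` range ((*v) B)"
    by (auto simp flip: matrix_vector_mul_assoc)
  then show ?thesis
    unfolding rank_eq_dim_range by (simp add: vec.dim_image_le)
qed

lemma rank_add_le:
  fixes A B :: "'a::field^'n^'m"
  shows "rank (A + B) \<le> rank A + rank B"
proof -
  let ?S = "range ((*v) A)" and ?T = "range ((*v) B)"
  have "range ((*v) (A + B)) \<subseteq> {x + y |x y. x \<in> ?S \<and> y \<in> ?T}"
    by (auto simp: matrix_vector_mult_add_rdistrib)
  then have "rank (A + B) \<le> vec.dim {x + y |x y. x \<in> ?S \<and> y \<in> ?T}"
    unfolding rank_eq_dim_range by (rule vec.dim_subset)
  also have "\<dots> + vec.dim (?S \<inter> ?T) = rank A + rank B"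
    unfolding rank_eq_dim_range by (intro vec.dim_sums_Int vec.subspace_image) simp_all
  finally show ?thesis
    by linarith
qed

text \<open>\<open>E\<close> fixes its range and annihilates that of \<open>mat 1 - E\<close>, so
  the two ranges meet only in 0 and their dimensions add.\<close>

lemma rank_idempotent_complement:
  fixes E :: "'a::field^'n^'n"
  assumes "E ** E = E"
  shows "rank (mat 1 - E) + rank E \<le> CARD('n)"
proof -
  let ?S = "range ((*v) (mat 1 - E))" and ?T = "range ((*v) E)"
  have EE: "E *v (E *v x) = E *v x" for x
    by (simp add: assms matrix_vector_mul_assoc)
  have "?S \<inter> ?T \<subseteq> {0}"
  proof
    fix x assume "x \<in> ?S \<inter> ?T"
    then obtain y w where "x = (mat 1 - E) *v y" and w: "x = E *v w"
      by blast
    then have x: "x = y - E *v y" "x = E *v w"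
      by (simp_all add: matrix_vector_mult_diff_rdistrib)
    have "E *v x = x"
      by (simp add: x(2) EE)
    moreover have "E *v x = 0"
      by (simp add: x(1) EE matrix_vector_mult_diff_distrib)
    ultimately show "x \<in> {0}"
      by simp
  qed
  then have "vec.dim (?S \<inter> ?T) = 0"
    by simp
  moreover have "vec.dim {x + y |x y. x \<in> ?S \<and> y \<in> ?T} + vec.dim (?S \<inter> ?T)
      = rank (mat 1 - E) + rank E"
    unfolding rank_eq_dim_range by (intro vec.dim_sums_Int vec.subspace_image) simp_all
  moreover have "vec.dim {x + y |x y. x \<in> ?S \<and> y \<in> ?T} \<le> CARD('n)"
    by (rule dim_subset_UNIV_cart_gen)
  ultimately show ?thesis
    by linarith
qed

section \<open>Invariance of rank under complexification\<close>

definition cvec :: "real ^ 'n \<Rightarrow> complex ^ 'n" where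
  "cvec x = (\<chi> i. complex_of_real (x $ i))"

lemma inj_cvec: "inj cvec"
  by (auto simp: inj_def cvec_def vec_eq_iff)

text \<open>The real and imaginary parts of a complex relation between real vectors are real
  relations, so a real basis stays independent over the complex numbers.\<close>

lemma dim_cvec_image: "vec.dim (cvec ` X) = vec.dim X"
proof -
  obtain B where B: "B \<subseteq> X" "vec.independent B" "X \<subseteq> vec.span B" "card B = vec.dim X"
    using vec.basis_exists by blast
  have fin: "finite B"
    using B(2) by (rule vec.finiteI_independent)
  have inj: "inj_on cvec B"
    using inj_cvec by (rule inj_on_subset) simp
  have zero: "f b = 0" if "(\<Sum>b\<in>B. f b *s b) = 0" "b \<in> B" for f b
    using B(2) that unfolding vec.independent_explicit by blast
  show ?thesis
  proof (rule vec.dim_unique)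
    show "cvec ` B \<subseteq> cvec ` X"
      using B(1) by blast
    show "cvec ` X \<subseteq> vec.span (cvec ` B)"
    proof clarify
      fix x assume "x \<in> X"
      then obtain c where "x = (\<Sum>b\<in>B. c b *s b)"
        using B(3) by (auto simp: vec.span_finite[OF fin])
      then have "cvec x = (\<Sum>b\<in>B. complex_of_real (c b) *s cvec b)"
        by (simp add: vec_eq_iff cvec_def)
      also have "\<dots> \<in> vec.span (cvec ` B)"
        by (intro vec.span_sum vec.span_scale vec.span_base imageI)
      finally show "cvec x \<in> vec.span (cvec ` B)" .
    qed
    show "vec.independent (cvec ` B)"
    proof (rule vec.independent_if_scalars_zero)
      fix f x assume "(\<Sum>x\<in>cvec ` B. f x *s x) = 0" and "x \<in> cvec ` B"
      then obtain b where b: "b \<in> B" "x = cvec b" and "(\<Sum>b\<in>B. f (cvec b) *s cvec b) = 0"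
        by (auto simp: sum.reindex[OF inj])
      then have *: "(\<Sum>b\<in>B. f (cvec b) * complex_of_real (b $ i)) = 0" for i
        by (simp add: vec_eq_iff cvec_def)
      have "(\<Sum>b\<in>B. Re (f (cvec b)) *s b) = 0" "(\<Sum>b\<in>B. Im (f (cvec b)) *s b) = 0"
        using arg_cong[OF *, of Re] arg_cong[OF *, of Im]
        by (simp_all add: vec_eq_iff)
      then have "Re (f (cvec b)) = 0" "Im (f (cvec b)) = 0"
        using zero[of "\<lambda>b. Re (f (cvec b))", OF _ b(1)] zero[of "\<lambda>b. Im (f (cvec b))", OF _ b(1)]
        by blast+
      then show "f x = 0"
        by (simp add: b(2) complex_eq_iff)
    qed (simp add: fin)
    show "card (cvec ` B) = vec.dim X"
      using B(4) by (simp add: card_image[OF inj])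
  qed
qed

lemma rank_cmat: "rank (cmat M) = rank M"
proof -
  have "rows (cmat M) = cvec ` rows M"
    by (auto simp: rows_def row_def cvec_def cmat_def image_iff)
  then show ?thesis
    by (simp add: row_rank_def_gen dim_cvec_image)
qed

section \<open>Adjoints, orthonormal families and pseudoinverses\<close>

text \<open>Conjugate-linear in the first argument, to match the sum in
  \<open>orthonormal_family\<close>.\<close>

definition cinner :: "complex ^ 'n \<Rightarrow> complex ^ 'n \<Rightarrow> complex" where
  "cinner x y = (\<Sum>k\<in>UNIV. cnj (x $ k) * y $ k)"

lemma cinner_zero_right [simp]: "cinner x 0 = 0"
  by (simp add: cinner_def)

lemma cinner_zero_left [simp]: "cinner 0 x = 0"
  by (simp add: cinner_def)

lemma cinner_add_right: "cinner x (y + z) = cinner x y + cinner x z"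
  by (simp add: cinner_def distrib_left sum.distrib)

lemma cinner_scale_right: "cinner x (c *s y) = c * cinner x y"
  by (simp add: cinner_def sum_distrib_left algebra_simps)

lemma cinner_sum_right: "cinner x (\<Sum>i\<in>I. f i) = (\<Sum>i\<in>I. cinner x (f i))"
  by (induction I rule: infinite_finite_induct) (simp_all add: cinner_add_right)

lemma cinner_commute: "cinner y x = cnj (cinner x y)"
  by (simp add: cinner_def mult.commute)

lemma Re_cinner: "Re (cinner x y) = x \<bullet> y"
  by (simp add: cinner_def inner_vec_def inner_complex_def)

lemma cinner_self: "cinner x x = complex_of_real ((norm x)\<^sup>2)"
proof (rule complex_eqI)
  show "Re (cinner x x) = Re (complex_of_real ((norm x)\<^sup>2))"
    by (simp add: Re_cinner power2_norm_eq_inner)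
  show "Im (cinner x x) = Im (complex_of_real ((norm x)\<^sup>2))"
    by (simp add: cinner_def mult.commute)
qed

lemma cinner_self_eq_0 [simp]: "cinner x x = 0 \<longleftrightarrow> x = 0"
  by (simp add: cinner_self)

lemma ctranspose_ctranspose [simp]: "ctranspose (ctranspose M) = M"
  by (simp add: ctranspose_def vec_eq_iff)

lemma ctranspose_mult: "ctranspose (A ** B) = ctranspose B ** ctranspose A"
  by (simp add: ctranspose_def matrix_matrix_mult_def vec_eq_iff mult.commute)

lemma ctranspose_mat_1 [simp]: "ctranspose (mat 1) = mat 1"
  by (auto simp: ctranspose_def mat_def vec_eq_iff)

lemma cinner_mult_right: "cinner x (M *v y) = cinner (ctranspose M *v x) y"
  unfolding cinner_def ctranspose_def matrix_vector_mult_def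
  by (simp add: sum_distrib_left sum_distrib_right mult_ac, subst sum.swap, rule refl)

text \<open>Penrose's argument: \<open>M ** X\<close> and \<open>M ** Y\<close> are self-adjoint
  left identities for each other, so passing to adjoints identifies them; likewise, on the right,
  \<open>X ** M\<close> and \<open>Y ** M\<close>.\<close>

lemma is_pinv_unique:
  assumes X: "is_pinv M X" and Y: "is_pinv M Y"
  shows "X = Y"
proof -
  have MX: "M ** X = M ** Y"
  proof -
    have "M ** X = (M ** Y) ** (M ** X)"
      using Y by (simp add: is_pinv_def matrix_mul_assoc)
    also have "\<dots> = ctranspose ((M ** X) ** (M ** Y))"
      using X Y by (simp add: is_pinv_def ctranspose_mult)
    also have "(M ** X) ** (M ** Y) = M ** Y"
      using X by (simp add: is_pinv_def matrix_mul_assoc)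
    finally show ?thesis
      using Y by (simp add: is_pinv_def)
  qed
  have XM: "X ** M = Y ** M"
  proof -
    have "X ** M = (X ** M) ** (Y ** M)"
      using Y by (simp add: is_pinv_def flip: matrix_mul_assoc)
    also have "\<dots> = ctranspose ((Y ** M) ** (X ** M))"
      using X Y by (simp add: is_pinv_def ctranspose_mult)
    also have "(Y ** M) ** (X ** M) = Y ** M"
      using X by (simp add: is_pinv_def flip: matrix_mul_assoc)
    finally show ?thesis
      using Y by (simp add: is_pinv_def)
  qed
  have "X = X ** (M ** X)"
    using X by (simp add: is_pinv_def matrix_mul_assoc)
  also have "\<dots> = (X ** M) ** Y"
    by (simp add: MX matrix_mul_assoc)
  also have "\<dots> = Y"
    using Y by (simp add: XM is_pinv_def)
  finally show ?thesis .
qed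

lemma pinv_eqI: "is_pinv M X \<Longrightarrow> pinv M = X"
  unfolding pinv_def by (rule the_equality) (auto intro: is_pinv_unique)

text \<open>Full row rank makes the Gram matrix of the rows invertible, and with inverse
  \<open>R\<close> the pseudoinverse is \<open>ctranspose M ** R\<close>.\<close>

lemma full_row_rank_pinv:
  fixes M :: "complex ^ 'c ^ 'r"
  assumes "rank M = CARD('r)"
  shows "is_pinv M (pinv M)" and "M ** pinv M = mat 1"
proof -
  let ?M' = "ctranspose M"
  have "y = 0" if "(M ** ?M') *v y = 0" for y
  proof -
    have "cinner (?M' *v y) (?M' *v y) = cinner y ((M ** ?M') *v y)"
      by (simp add: cinner_mult_right flip: matrix_vector_mul_assoc)
    then have "?M' *v y = 0"
      using that by simp
    \<comment> \<open>\<open>y\<close> is orthogonal to the range of \<open>M\<close>, which is the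
      whole space.\<close>
    then have "cinner y (M *v x) = 0" for x
      by (simp add: cinner_mult_right)
    moreover obtain x where "y = M *v x"
      using surj_if_full_row_rank[OF assms] by blast
    ultimately show "y = 0"
      by (metis cinner_self_eq_0)
  qed
  then obtain R where R: "R ** (M ** ?M') = mat 1"
    using matrix_left_invertible_ker[of "M ** ?M'"] by auto
  then have R': "(M ** ?M') ** R = mat 1"
    by (simp add: matrix_left_right_inverse)
  \<comment> \<open>The last Penrose condition, for \<open>?M' ** R ** M\<close>, rests on
    \<open>R\<close> being self-adjoint.\<close>
  have "ctranspose R = ctranspose R ** ((M ** ?M') ** R)"
    by (simp add: R')
  also have "\<dots> = ctranspose ((M ** ?M') ** R) ** R"
    by (simp add: ctranspose_mult matrix_mul_assoc)
  also have "\<dots> = R"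
    by (simp add: R')
  finally have herm: "ctranspose R = R" .
  let ?X = "?M' ** R"
  have MX: "M ** ?X = mat 1"
    using R' by (simp add: matrix_mul_assoc)
  have "is_pinv M ?X"
    unfolding is_pinv_def using MX herm
    by (simp add: ctranspose_mult flip: matrix_mul_assoc)
  then show "is_pinv M (pinv M)" "M ** pinv M = mat 1"
    using MX by (simp_all add: pinv_eqI)
qed

section \<open>Real matrices among the complex ones\<close>

definition real_entries :: "complex ^ 'c ^ 'r \<Rightarrow> bool" where
  "real_entries M \<longleftrightarrow> (\<forall>i j. M $ i $ j \<in> \<real>)"

lemma real_entries_mult: "real_entries A \<Longrightarrow> real_entries B \<Longrightarrow> real_entries (A ** B)"
  unfolding real_entries_def matrix_matrix_mult_def by auto

lemma real_entries_iff_cnj: "real_entries M \<longleftrightarrow> map_matrix cnj M = M"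
  by (simp add: real_entries_def Reals_cnj_iff vec_eq_iff)

lemma map_matrix_cnj_mult: "map_matrix cnj (A ** B) = map_matrix cnj A ** map_matrix cnj B"
  by (simp add: matrix_matrix_mult_def vec_eq_iff)

text \<open>The entrywise conjugate of a pseudoinverse is again one, so uniqueness makes it real.\<close>

lemma real_entries_pinv:
  assumes "real_entries M" and X: "is_pinv M X"
  shows "real_entries X"
proof -
  have M: "map_matrix cnj M = M"
    using assms(1) by (simp add: real_entries_iff_cnj)
  have ct: "ctranspose (map_matrix cnj Z) = map_matrix cnj (ctranspose Z)"
    for Z :: "complex ^ 'x ^ 'y"
    by (simp add: ctranspose_def vec_eq_iff)
  have "is_pinv (map_matrix cnj M) (map_matrix cnj X)"
    using X unfolding is_pinv_def by (simp add: ct flip: map_matrix_cnj_mult)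
  then have "map_matrix cnj X = X"
    unfolding M by (rule is_pinv_unique[OF _ X])
  then show ?thesis
    by (simp add: real_entries_iff_cnj)
qed

section \<open>Orthonormal families and Bessel's inequality\<close>

declare One_nat_def [simp del]

lemma orthonormal_family_cinner:
  "orthonormal_family m w \<Longrightarrow> i \<in> {1..m} \<Longrightarrow> j \<in> {1..m} \<Longrightarrow>
    cinner (w i) (w j) = (if i = j then 1 else 0)"
  by (simp add: orthonormal_family_def cinner_def)

lemma orthonormal_family_mono: "orthonormal_family m w \<Longrightarrow> k \<le> m \<Longrightarrow> orthonormal_family k w"
  by (auto simp: orthonormal_family_def)

lemma cinner_orthonormal_sum:
  assumes "orthonormal_family k y" "i \<in> {1..k}"
  shows "cinner (y i) (\<Sum>j = 1..k. c j *s y j) = c i"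
proof -
  have "cinner (y i) (\<Sum>j = 1..k. c j *s y j) = (\<Sum>j = 1..k. if i = j then c j else 0)"
    unfolding cinner_sum_right
    by (rule sum.cong) (auto simp: cinner_scale_right orthonormal_family_cinner[OF assms])
  then show ?thesis
    using assms(2) by simp
qed

lemma norm_orthonormal_sum:
  assumes "orthonormal_family k y"
  shows "(norm (\<Sum>i = 1..k. c i *s y i))\<^sup>2 = (\<Sum>i = 1..k. (cmod (c i))\<^sup>2)"
proof -
  let ?s = "\<Sum>i = 1..k. c i *s y i"
  have "cinner ?s ?s = (\<Sum>i = 1..k. c i * cinner ?s (y i))"
    by (simp add: cinner_sum_right cinner_scale_right)
  also have "\<dots> = (\<Sum>i = 1..k. c i * cnj (c i))"
    by (rule sum.cong)
      (use cinner_orthonormal_sum[OF assms] in \<open>auto simp: cinner_commute[of ?s]\<close>)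
  also have "\<dots> = complex_of_real (\<Sum>i = 1..k. (cmod (c i))\<^sup>2)"
    by (simp only: complex_norm_square of_real_sum)
  finally show ?thesis
    unfolding cinner_self by (rule of_real_eq_iff[THEN iffD1])
qed

text \<open>The orthogonal projection \<open>?p\<close> of \<open>w\<close> satisfies
  \<open>w \<bullet> ?p = (norm ?p)\<^sup>2\<close>, so Cauchy-Schwarz gives
  \<open>norm ?p \<le> norm w\<close>.\<close>

lemma bessel_inequality:
  assumes "orthonormal_family k y"
  shows "(\<Sum>i = 1..k. (cmod (cinner (y i) w))\<^sup>2) \<le> (norm w)\<^sup>2"
proof -
  let ?p = "\<Sum>i = 1..k. cinner (y i) w *s y i"
  have "cinner w ?p = (\<Sum>i = 1..k. cinner (y i) w * cnj (cinner (y i) w))"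
    by (simp add: cinner_sum_right cinner_scale_right cinner_commute[of w])
  also have "\<dots> = complex_of_real ((norm ?p)\<^sup>2)"
    by (simp only: complex_norm_square of_real_sum norm_orthonormal_sum[OF assms])
  finally have "w \<bullet> ?p = (norm ?p)\<^sup>2"
    by (simp flip: Re_cinner)
  then have "norm ?p * norm ?p \<le> norm w * norm ?p"
    using norm_cauchy_schwarz[of w ?p] by (simp add: power2_eq_square)
  then have "norm ?p \<le> norm w"
    by (cases "norm ?p = 0") (auto dest: mult_right_le_imp_le)
  then show ?thesis
    unfolding norm_orthonormal_sum[OF assms, symmetric] by (rule power_mono) simp
qed

lemma orthonormal_family_inj:
  assumes "orthonormal_family k y"
  shows "inj_on y {1..k}"
proof (rule inj_onI, rule ccontr)
  fix i j assume *: "i \<in> {1..k}" "j \<in> {1..k}" "y i = y j" "i \<noteq> j"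
  show False
    using orthonormal_family_cinner[OF assms *(1,1)] orthonormal_family_cinner[OF assms *(1,2)] *(3,4)
    by simp
qed

lemma orthonormal_family_independent:
  assumes "orthonormal_family k y"
  shows "vec.independent (y ` {1..k})"
proof (rule vec.independent_if_scalars_zero)
  fix f x assume "(\<Sum>x\<in>y ` {1..k}. f x *s x) = 0" and "x \<in> y ` {1..k}"
  then obtain i where i: "i \<in> {1..k}" "x = y i" and "(\<Sum>j = 1..k. f (y j) *s y j) = 0"
    by (auto simp: sum.reindex[OF orthonormal_family_inj[OF assms]])
  then show "f x = 0"
    using cinner_orthonormal_sum[OF assms i(1), of "\<lambda>j. f (y j)"] by simp
qed simp

section \<open>Singular expansions\<close>

text \<open>One shape for a matrix in singular form, its adjoint, its pseudoinverse and the
  projections onto singular vectors, so that identities between them reduce to identities between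
  coefficients.\<close>

definition svd_sum :: "nat \<Rightarrow> (nat \<Rightarrow> real) \<Rightarrow> (nat \<Rightarrow> complex ^ 'r) \<Rightarrow> (nat \<Rightarrow> complex ^ 'c)
    \<Rightarrow> complex ^ 'c ^ 'r" where
  "svd_sum k a x y = (\<Sum>i = 1..k. a i *\<^sub>R outer (x i) (y i))"

lemma svd_sum_vec:
  "svd_sum k a x y *v w = (\<Sum>i = 1..k. (complex_of_real (a i) * cinner (y i) w) *s x i)"
proof (induction k)
  case (Suc k)
  have "(a (Suc k) *\<^sub>R outer (x (Suc k)) (y (Suc k))) *v w
      = (complex_of_real (a (Suc k)) * cinner (y (Suc k)) w) *s x (Suc k)"
    by (simp add: vec_eq_iff matrix_vector_mult_def outer_def cinner_def sum_distrib_left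
        sum_distrib_right mult_ac) (simp add: scaleR_conv_of_real mult_ac)
  with Suc show ?case
    by (simp add: svd_sum_def matrix_vector_mult_add_rdistrib)
qed (simp add: svd_sum_def)

lemma svd_sum_mult:
  assumes "orthonormal_family k y"
  shows "svd_sum k a x y ** svd_sum k b y w = svd_sum k (\<lambda>i. a i * b i) x w"
proof -
  have "svd_sum k a x y *v (svd_sum k b y w *v z) = svd_sum k (\<lambda>i. a i * b i) x w *v z" for z
    unfolding svd_sum_vec
    by (rule sum.cong) (simp_all add: cinner_orthonormal_sum[OF assms] mult.assoc)
  then show ?thesis
    by (simp add: matrix_eq flip: matrix_vector_mul_assoc)
qed

lemma ctranspose_svd_sum: "ctranspose (svd_sum k a x y) = svd_sum k a y x"
  by (simp add: vec_eq_iff ctranspose_def svd_sum_def outer_def mult.commute)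

lemma svd_sum_cong: "(\<And>i. i \<in> {1..k} \<Longrightarrow> a i = b i) \<Longrightarrow> svd_sum k a x y = svd_sum k b x y"
  by (simp add: svd_sum_def)

lemma K_tilde_eq: "K_tilde u \<sigma> v k = - svd_sum k (\<lambda>i. 1 / \<sigma> i) v u"
  by (simp add: K_tilde_def svd_sum_def)

lemma rank_svd_sum_le: "rank (svd_sum k a x y) \<le> k"
proof -
  have "range ((*v) (svd_sum k a x y)) \<subseteq> vec.span (x ` {1..k})"
    unfolding svd_sum_vec image_subset_iff
    by (intro ballI vec.span_sum vec.span_scale vec.span_base imageI)
  then have "rank (svd_sum k a x y) \<le> card (x ` {1..k})"
    unfolding rank_eq_dim_range by (rule vec.dim_le_card) simp
  also have "\<dots> \<le> k"
    using card_image_le[of "{1..k}" x] by simp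
  finally show ?thesis .
qed

text \<open>Each \<open>y j\<close> is fixed by the projection, whose range thus contains
  \<open>k\<close> independent vectors.\<close>

lemma rank_projection_ge:
  assumes "orthonormal_family k y"
  shows "k \<le> rank (svd_sum k (\<lambda>i. 1) y y)"
proof -
  have "svd_sum k (\<lambda>i. 1) y y *v y j = y j" if "j \<in> {1..k}" for j
  proof -
    have "svd_sum k (\<lambda>i. 1) y y *v y j = (\<Sum>i = 1..k. if i = j then y i else 0)"
      unfolding svd_sum_vec
      by (rule sum.cong) (auto simp: orthonormal_family_cinner[OF assms _ that])
    then show ?thesis
      using that by simp
  qed
  then have "y ` {1..k} \<subseteq> range ((*v) (svd_sum k (\<lambda>i. 1) y y))"
    by (metis image_subsetI rangeI)
  then have "card (y ` {1..k}) \<le> rank (svd_sum k (\<lambda>i. 1) y y)"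
    unfolding rank_eq_dim_range
    by (rule vec.independent_card_le_dim[OF _ orthonormal_family_independent[OF assms]])
  then show ?thesis
    by (simp add: card_image[OF orthonormal_family_inj[OF assms]])
qed

text \<open>Both products have all coefficients 1 and are self-adjoint by symmetry; the other two
  conditions cancel \<open>\<sigma> i\<close> against its inverse.\<close>

lemma is_pinv_svd_sum:
  assumes "orthonormal_family k u" "orthonormal_family k v" "\<And>i. i \<in> {1..k} \<Longrightarrow> \<sigma> i \<noteq> 0"
  shows "is_pinv (svd_sum k \<sigma> u v) (svd_sum k (\<lambda>i. 1 / \<sigma> i) v u)"
  unfolding is_pinv_def svd_sum_mult[OF assms(1)] svd_sum_mult[OF assms(2)] ctranspose_svd_sum
  using assms(3) by (auto intro!: svd_sum_cong)

text \<open>Descending order makes the indices of the positive singular values an initial segment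
  \<open>{1..t}\<close>, and all later terms vanish.\<close>

lemma is_svd_truncate:
  fixes M :: "complex ^ 'c ^ 'r"
  assumes "is_svd M u \<sigma> v"
  obtains t where "orthonormal_family t u" "orthonormal_family t v"
    "t \<le> CARD('r)" "t \<le> CARD('c)"
    "\<And>i. i \<in> {1..t} \<Longrightarrow> 0 < \<sigma> i" "M = svd_sum t \<sigma> u v"
proof -
  let ?m = "min CARD('r) CARD('c)"
  have nonneg: "0 \<le> \<sigma> i" and anti: "j \<in> {1..?m} \<Longrightarrow> i \<le> j \<Longrightarrow> \<sigma> j \<le> \<sigma> i"
    if "i \<in> {1..?m}" for i j
    using assms that unfolding is_svd_def by blast+
  define T where "T = {i \<in> {1..?m}. 0 < \<sigma> i}"
  have T: "i \<in> T" if "j \<in> T" "1 \<le> i" "i \<le> j" for i j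
    using that anti[of i j] by (force simp: T_def)
  obtain t where t: "T = {1..t}" "t \<le> ?m"
  proof (cases "T = {}")
    case True
    then show ?thesis
      by (intro that[of 0]) auto
  next
    case False
    have fin: "finite T"
      by (simp add: T_def)
    have max: "Max T \<in> T"
      using fin False by (rule Max_in)
    have "T = {1..Max T}"
    proof
      show "T \<subseteq> {1..Max T}"
        using Max_ge[OF fin] by (auto simp: T_def)
      show "{1..Max T} \<subseteq> T"
        using T[OF max] by auto
    qed
    moreover have "Max T \<le> ?m"
      using max by (simp add: T_def)
    ultimately show ?thesis
      by (rule that)
  qed
  show ?thesis
  proof (rule that[of t])
    show "orthonormal_family t u" "orthonormal_family t v"
      using assms t(2) unfolding is_svd_def by (auto intro: orthonormal_family_mono)
    show "t \<le> CARD('r)" "t \<le> CARD('c)"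
      using t(2) by simp_all
    show "0 < \<sigma> i" if "i \<in> {1..t}" for i
    proof -
      have "i \<in> T"
        using that t(1) by simp
      then show ?thesis
        by (simp add: T_def)
    qed
    have "\<sigma> i = 0" if "i \<in> {1..?m} - {1..t}" for i
    proof -
      have "i \<notin> T"
        using that t(1) by simp
      then show ?thesis
        using that nonneg[of i] by (auto simp: T_def)
    qed
    then have "(\<Sum>i = 1..?m. \<sigma> i *\<^sub>R outer (u i) (v i)) = svd_sum t \<sigma> u v"
      unfolding svd_sum_def using t(2) by (intro sum.mono_neutral_right) auto
    then show "M = svd_sum t \<sigma> u v"
      using assms unfolding is_svd_def by simp
  qed
qed

section \<open>Norm bounds\<close>

lemma spectral_norm_nonneg: "0 \<le> spectral_norm M"
  unfolding spectral_norm_def by (rule onorm_pos_le) simp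

lemma spectral_norm_zero [simp]: "spectral_norm 0 = 0"
  by (simp add: spectral_norm_def onorm_zero)

lemma spectral_norm_minus: "spectral_norm (- M) = spectral_norm M"
proof -
  have "(\<lambda>x. (- M) *v x) = (\<lambda>x. - (M *v x))"
    by (simp add: fun_eq_iff vec_eq_iff matrix_vector_mult_def sum_negf)
  then show ?thesis
    by (simp add: spectral_norm_def onorm_neg)
qed

lemma spectral_norm_mult_le: "spectral_norm (A ** B) \<le> spectral_norm A * spectral_norm B"
proof -
  have "(\<lambda>x. (A ** B) *v x) = (\<lambda>x. A *v x) \<circ> (\<lambda>x. B *v x)"
    by (simp add: fun_eq_iff matrix_vector_mul_assoc)
  then show ?thesis
    unfolding spectral_norm_def by (metis onorm_compose matrix_vector_mul_bounded_linear)
qed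

text \<open>Pythagoras for \<open>x\<close> computes the norm of an image vector, and Bessel's
  inequality for \<open>y\<close> bounds it.\<close>

lemma spectral_norm_svd_sum_le:
  assumes "orthonormal_family k x" "orthonormal_family k y"
    and "\<And>i. i \<in> {1..k} \<Longrightarrow> \<bar>a i\<bar> \<le> c" "0 \<le> c"
  shows "spectral_norm (svd_sum k a x y) \<le> c"
  unfolding spectral_norm_def
proof (rule onorm_le)
  fix w
  have "(norm (svd_sum k a x y *v w))\<^sup>2 = (\<Sum>i = 1..k. (cmod (complex_of_real (a i) * cinner (y i) w))\<^sup>2)"
    unfolding svd_sum_vec by (rule norm_orthonormal_sum[OF assms(1)])
  also have "\<dots> \<le> (\<Sum>i = 1..k. (c * cmod (cinner (y i) w))\<^sup>2)"
    by (intro sum_mono power_mono) (auto simp: norm_mult intro!: mult_right_mono assms(3))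
  also have "\<dots> = c\<^sup>2 * (\<Sum>i = 1..k. (cmod (cinner (y i) w))\<^sup>2)"
    by (simp add: power_mult_distrib sum_distrib_left)
  also have "\<dots> \<le> c\<^sup>2 * (norm w)\<^sup>2"
    by (intro mult_left_mono bessel_inequality[OF assms(2)]) simp
  finally have "(norm (svd_sum k a x y *v w))\<^sup>2 \<le> (c * norm w)\<^sup>2"
    by (simp add: power_mult_distrib)
  then show "norm (svd_sum k a x y *v w) \<le> c * norm w"
    by (rule power2_le_imp_le) (simp add: assms(4))
qed

section \<open>Singular values and the nuclear norm\<close>

lemma sv_mult_pos_iff:
  "0 < sv_mult M s \<longleftrightarrow>
    (\<exists>x. x \<noteq> 0 \<and> (ctranspose M ** M) *v x = complex_of_real (s\<^sup>2) *s x)"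
  by (auto simp: sv_mult_def neq0_conv[symmetric] subset_iff simp del: neq0_conv)

text \<open>The adjoint times the matrix acts on \<open>y i\<close> as \<open>(a i)\<^sup>2\<close>
  and vanishes on the orthogonal complement of the family, whose eigenvalue 0 is excluded by
  \<open>0 < s\<close>.\<close>

lemma sv_mult_svd_sum:
  assumes "orthonormal_family k x" "orthonormal_family k y" "0 < s"
  shows "0 < sv_mult (svd_sum k a x y) s \<longleftrightarrow> (\<exists>i\<in>{1..k}. (a i)\<^sup>2 = s\<^sup>2)"
proof -
  let ?M = "svd_sum k a x y"
  have MM: "(ctranspose ?M ** ?M) *v w
      = (\<Sum>i = 1..k. (complex_of_real ((a i)\<^sup>2) * cinner (y i) w) *s y i)" for w
    unfolding ctranspose_svd_sum svd_sum_mult[OF assms(1)] svd_sum_vec by (simp add: power2_eq_square)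
  show ?thesis
  proof
    assume "0 < sv_mult ?M s"
    then obtain w where w: "w \<noteq> 0" "(ctranspose ?M ** ?M) *v w = complex_of_real (s\<^sup>2) *s w"
      unfolding sv_mult_pos_iff by blast
    have eq: "complex_of_real ((a i)\<^sup>2) * cinner (y i) w = complex_of_real (s\<^sup>2) * cinner (y i) w"
      if "i \<in> {1..k}" for i
    proof -
      have "complex_of_real ((a i)\<^sup>2) * cinner (y i) w = cinner (y i) ((ctranspose ?M ** ?M) *v w)"
        unfolding MM by (simp only: cinner_orthonormal_sum[OF assms(2) that])
      then show ?thesis
        by (simp only: w(2) cinner_scale_right)
    qed
    show "\<exists>i\<in>{1..k}. (a i)\<^sup>2 = s\<^sup>2"
    proof (rule ccontr)
      assume no: "\<not> ?thesis"
      have "cinner (y i) w = 0" if "i \<in> {1..k}" for i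
        using eq[OF that] no that by (auto simp only: mult_cancel_right of_real_eq_iff)
      then have "(ctranspose ?M ** ?M) *v w = 0"
        unfolding MM by simp
      then show False
        using w assms(3) by simp
    qed
  next
    assume "\<exists>i\<in>{1..k}. (a i)\<^sup>2 = s\<^sup>2"
    then obtain i where i: "i \<in> {1..k}" "(a i)\<^sup>2 = s\<^sup>2"
      by blast
    have "(ctranspose ?M ** ?M) *v y i = (\<Sum>j = 1..k. if j = i then complex_of_real (s\<^sup>2) *s y i else 0)"
      unfolding MM by (rule sum.cong) (auto simp: orthonormal_family_cinner[OF assms(2) _ i(1)] i(2)
          simp flip: of_real_power)
    then have "(ctranspose ?M ** ?M) *v y i = complex_of_real (s\<^sup>2) *s y i"
      using i(1) by simp
    moreover have "y i \<noteq> 0"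
      using orthonormal_family_cinner[OF assms(2) i(1,1)] by auto
    ultimately show "0 < sv_mult ?M s"
      unfolding sv_mult_pos_iff by blast
  qed
qed

text \<open>Each \<open>a i\<close> is a singular value of multiplicity at least 1, hence bounded by
  its own term of the nuclear norm, whose other terms are nonnegative.\<close>

lemma spectral_norm_le_nuclear_norm:
  assumes "orthonormal_family k x" "orthonormal_family k y"
    and pos: "\<And>i. i \<in> {1..k} \<Longrightarrow> 0 < a i"
  shows "spectral_norm (svd_sum k a x y) \<le> nuclear_norm (svd_sum k a x y)" (is "_ \<le> nuclear_norm ?M")
proof (rule spectral_norm_svd_sum_le[OF assms(1,2)])
  let ?Sv = "{s. 0 < s \<and> 0 < sv_mult ?M s}"
  have "(a i)\<^sup>2 = s\<^sup>2 \<longleftrightarrow> s = a i" if "i \<in> {1..k}" "0 < s" for i s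
    using pos[OF that(1)] that(2) by (auto simp: power2_eq_iff_nonneg)
  \<comment> \<open>In particular the index set of the nuclear norm is finite; over an infinite set
    the sum would be 0 by convention.\<close>
  then have Sv: "?Sv = a ` {1..k}"
    using pos by (auto simp: sv_mult_svd_sum[OF assms(1,2)] image_iff simp del: atLeastAtMost_iff)
  have nonneg: "0 \<le> real (sv_mult ?M s) * s" if "s \<in> ?Sv" for s
    using that by simp
  then show "0 \<le> nuclear_norm ?M"
    unfolding nuclear_norm_def by (rule sum_nonneg)
  show "\<bar>a i\<bar> \<le> nuclear_norm ?M" if "i \<in> {1..k}" for i
  proof -
    have i: "a i \<in> ?Sv"
      using that Sv by blast
    then have "1 * a i \<le> real (sv_mult ?M (a i)) * a i"
      by (intro mult_right_mono) auto
    also have "\<dots> \<le> nuclear_norm ?M"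
      unfolding nuclear_norm_def
    proof (rule member_le_sum[OF i])
      show "finite ?Sv"
        by (simp only: Sv finite_imageI finite_atLeastAtMost)
    qed (use nonneg in blast)
    finally show ?thesis
      using pos[OF that] by simp
  qed
qed

section \<open>Deflating the rank\<close>

lemma matrix_mult_minus_right: "A ** (- B) = - (A ** (B :: 'a::ring_1 ^ 'c ^ 'b))"
  by (simp add: matrix_matrix_mult_def vec_eq_iff sum_negf)

lemma matrix_diff_rdistrib: "(A - B) ** C = A ** C - B ** (C :: 'a::ring_1 ^ 'c ^ 'b)"
  by (simp add: matrix_matrix_mult_def vec_eq_iff left_diff_distrib sum_subtractf)

text \<open>Padding with zero coefficients lets \<open>svd_sum_mult\<close> multiply a truncated sum
  with one of length \<open>t\<close>.\<close>

lemma svd_sum_extend: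
  assumes "k \<le> t"
  shows "svd_sum k a x y = svd_sum t (\<lambda>i. if i \<le> k then a i else 0) x y"
  unfolding svd_sum_def using assms by (intro sum.mono_neutral_cong_left) auto

text \<open>
  Writing \<open>D\<^sup>+\<close> for the pseudoinverse and \<open>P\<close> for the orthogonal projection onto the span of the first
  \<open>k\<close> left singular vectors of \<open>D\<^sup>+ F\<close>, one has \<open>D + F K = D - D P = (I - E) D\<close> for the idempotent
  \<open>E = D P D\<^sup>+\<close>, because \<open>P D\<^sup>+ D = P\<close>.
\<close>

lemma rank_deflation:
  fixes D :: "complex ^ 'c ^ 'r" and F :: "complex ^ 'm ^ 'r"
  assumes rank: "rank D = CARD('r)" and M: "pinv D ** F = svd_sum t \<sigma> u v"
    and orth: "orthonormal_family t u" "orthonormal_family t v"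
    and pos: "\<And>i. i \<in> {1..t} \<Longrightarrow> 0 < \<sigma> i" and k: "k \<le> t"
  shows "rank (D + F ** K_tilde u \<sigma> v k) + k \<le> CARD('r)"
proof -
  let ?D' = "pinv D" and ?M = "pinv D ** F"
  define X where "X = svd_sum k (\<lambda>i. 1 / \<sigma> i) v u"
  define P where "P = svd_sum k (\<lambda>i. 1) u u"
  define E where "E = D ** P ** ?D'"
  note pinv = full_row_rank_pinv(1)[OF rank] and right_inv = full_row_rank_pinv(2)[OF rank]
  have MX: "?M ** X = P"
    unfolding M X_def P_def svd_sum_extend[OF k] svd_sum_mult[OF orth(2)]
    using pos by (intro svd_sum_cong) (auto simp: order_less_imp_not_eq2)
  have PP: "P ** P = P"
    unfolding P_def svd_sum_mult[OF orthonormal_family_mono[OF orth(1) k]] by simp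
  have herm: "ctranspose P = P"
    by (simp add: P_def ctranspose_svd_sum)
  \<comment> \<open>\<open>?D' ** D\<close> is the identity on the range of \<open>?D'\<close>,
    hence on those of \<open>?M\<close> and of \<open>P = ?M ** X\<close>.\<close>
  have "?D' ** D ** ?M = ?M"
    using pinv by (simp add: is_pinv_def matrix_mul_assoc)
  then have DP: "?D' ** D ** P = P"
    by (metis MX matrix_mul_assoc)
  \<comment> \<open>This is the adjoint of \<open>DP\<close>, both factors being
    self-adjoint.\<close>
  have PD: "P ** (?D' ** D) = P"
  proof -
    have "P ** (?D' ** D) = ctranspose (?D' ** D ** P)"
      using pinv herm by (simp only: ctranspose_mult[of "?D' ** D" P] is_pinv_def)
    then show ?thesis
      by (simp add: DP herm)
  qed
  have "E ** E = D ** (P ** (?D' ** D)) ** P ** ?D'"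
    by (simp add: E_def matrix_mul_assoc)
  also have "\<dots> = D ** (P ** P) ** ?D'"
    by (simp only: PD) (simp only: matrix_mul_assoc)
  finally have idem: "E ** E = E"
    by (simp add: PP E_def)
  \<comment> \<open>Recovering \<open>P\<close> from \<open>E\<close> by multiplication bounds the
    rank of \<open>E\<close> below by \<open>k\<close>.\<close>
  have "?D' ** E ** D = ?D' ** D ** (P ** (?D' ** D))"
    by (simp add: E_def matrix_mul_assoc)
  then have "P = ?D' ** E ** D"
    by (simp add: PD DP)
  then have "rank P \<le> rank E"
    by (metis rank_mult_le_left rank_mult_le_right order_trans)
  then have rank_E: "k \<le> rank E"
    using rank_projection_ge[OF orthonormal_family_mono[OF orth(1) k]]
    unfolding P_def by linarith
  have "F ** X = (D ** ?D') ** F ** X"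
    by (simp add: right_inv)
  also have "\<dots> = D ** (?M ** X)"
    by (simp add: matrix_mul_assoc)
  also have "\<dots> = D ** (P ** (?D' ** D))"
    by (simp add: MX PD)
  also have "\<dots> = E ** D"
    by (simp add: E_def matrix_mul_assoc)
  finally have "D + F ** K_tilde u \<sigma> v k = (mat 1 - E) ** D"
    by (simp add: K_tilde_eq matrix_mult_minus_right matrix_diff_rdistrib flip: X_def)
  then have "rank (D + F ** K_tilde u \<sigma> v k) \<le> rank (mat 1 - E)"
    by (simp add: rank_mult_le_left)
  then show ?thesis
    using rank_idempotent_complement[OF idem] rank_E by linarith
qed

section \<open>Realness of the solutions, and the assembled result\<close>

lemma real_entries_D_bar: "z \<in> \<real> \<Longrightarrow> real_entries (D_bar A B G H z)"
  by (auto simp: real_entries_def D_bar_def vcat_def hcat_def cmat_def mat_def split: sum.splits)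

lemma real_entries_cmat: "real_entries (cmat M)"
  by (simp add: real_entries_def cmat_def)

lemma real_entries_minus: "real_entries M \<Longrightarrow> real_entries (- M)"
  by (simp add: real_entries_def)

text \<open>A sum that cuts through a repeated singular value depends on the chosen singular
  vectors, so its realness is drawn from theirs.\<close>

lemma real_entries_K_tilde:
  assumes "\<And>i j. i \<in> {1..k} \<Longrightarrow> u i $ j \<in> \<real>" "\<And>i j. i \<in> {1..k} \<Longrightarrow> v i $ j \<in> \<real>"
  shows "real_entries (K_tilde u \<sigma> v k)"
  unfolding real_entries_def K_tilde_def outer_def
  using assms by (auto simp: complex_is_Real_iff)

text \<open>\<open>S\<close> selects real or complex \<open>K\<close>. Rank and norm estimates are
  made over the complex numbers for both; realness enters only through membership in
  \<open>feasible_set\<close>.\<close>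

theorem lemma5p1:
  fixes A :: "real ^ 'n ^ 'n" and B :: "real ^ 'p ^ 'n"
    and G' :: "real ^ 'n ^ 'l" and H' :: "real ^ 'p ^ 'l" and P :: "real ^ 'l ^ 'q"
    and G :: "real ^ 'n ^ 'q" and H :: "real ^ 'p ^ 'q"
    and D :: "complex \<Rightarrow> complex ^ ('n + 'p) ^ ('n + 'q)"
    and F :: "real ^ ('p + 'l) ^ ('n + 'q)"
    and W :: "complex ^ ('p + 'l) ^ 'q"
    and z :: complex and \<rho> N :: nat and S :: "complex set"
    and u :: "nat \<Rightarrow> complex ^ ('n + 'p)" and \<sigma> :: "nat \<Rightarrow> real"
    and v :: "nat \<Rightarrow> complex ^ ('p + 'l)"
  assumes G_eq: "G = P ** G'" and H_eq: "H = P ** H'"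
    and D_eq: "D = D_bar A B G H" and F_eq: "F = F_mat B H P"
    and W_eq: "W = cmat (hcat H P)"
    and N_eq: "N = CARD('n) + CARD('q)"
    and full_row_rank: "\<forall>\<zeta>. rank (D \<zeta>) = N"
    and rho: "\<rho> \<ge> 1"
    and scalars: "S = UNIV \<or> S = \<real>"
    and svd: "is_svd (pinv (D z) ** cmat F) u \<sigma> v"
  shows
    \<comment> \<open>(i): necessity holds as it stands; sufficiency over the reals needs a real \<open>z\<close>\<close>
    "(feasible_set S (D z) (cmat F) \<rho> \<noteq> {} \<longrightarrow> \<rho> \<ge> N - rank F + 1) \<and>
     ((S = \<real> \<longrightarrow> z \<in> \<real>) \<longrightarrow>
        (feasible_set S (D z) (cmat F) \<rho> \<noteq> {} \<longleftrightarrow> \<rho> \<ge> N - rank F + 1)) \<and>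
     \<comment> \<open>(ii)\<close>
     (\<rho> > N \<longrightarrow>
        is_optimal_solution S W (D z) (cmat F) \<rho> 0 \<and>
        optimal_value S W (D z) (cmat F) \<rho> = 0) \<and>
     \<comment> \<open>(iii): over the reals, \<open>z\<close> has to be real, and the decomposition a real one\<close>
     (N - rank F + 1 \<le> \<rho> \<and> \<rho> \<le> N \<longrightarrow>
        ((S = \<real> \<longrightarrow> z \<in> \<real> \<and> (\<forall>i\<in>{1..CARD('n) + CARD('p)}. \<forall>k. u i $ k \<in> \<real>)
                       \<and> (\<forall>i\<in>{1..CARD('p) + CARD('l)}. \<forall>k. v i $ k \<in> \<real>)) \<longrightarrow>
           K_tilde u \<sigma> v (N - \<rho> + 1) \<in> feasible_set S (D z) (cmat F) \<rho>) \<and>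
        ((S = \<real> \<longrightarrow> z \<in> \<real>) \<longrightarrow>
           optimal_value S W (D z) (cmat F) \<rho>
             \<le> ereal (spectral_norm W * nuclear_norm (pinv (pinv (D z) ** cmat F)))))"
proof -
  let ?Dz = "D z" and ?F = "cmat F" and ?K = "K_tilde u \<sigma> v"
  let ?M = "pinv ?Dz ** ?F" and ?feas = "feasible_set S (D z) (cmat F) \<rho>"
  have rank_D: "rank ?Dz = CARD('n + 'q)"
    using full_row_rank N_eq by simp
  obtain t where t: "orthonormal_family t u" "orthonormal_family t v"
      "t \<le> CARD('n + 'p)" "t \<le> CARD('p + 'l)" "\<And>i. i \<in> {1..t} \<Longrightarrow> 0 < \<sigma> i"
      and M: "?M = svd_sum t \<sigma> u v"
    by (rule is_svd_truncate[OF svd]) (rule that)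
  \<comment> \<open>Recovering \<open>?F\<close> from \<open>?M\<close> shows that there are at
    least \<open>rank F\<close> positive singular values.\<close>
  have "?F = ?Dz ** ?M"
    by (simp add: full_row_rank_pinv(2)[OF rank_D] matrix_mul_assoc)
  then have "rank ?F \<le> rank ?M"
    by (metis rank_mult_le_right)
  then have rank_F: "rank F \<le> t"
    using rank_svd_sum_le[of t \<sigma> u v] by (simp add: rank_cmat M)
  have rank_K: "rank (?Dz + ?F ** ?K k) + k \<le> N" if "k \<le> t" for k
    using rank_deflation[OF rank_D M t(1,2,5) that] by (simp add: N_eq)
  have pinv_M: "is_pinv ?M (svd_sum t (\<lambda>i. 1 / \<sigma> i) v u)"
    unfolding M using t(1,2,5) by (intro is_pinv_svd_sum) (auto simp: less_le)
  \<comment> \<open>With all \<open>t\<close> terms, \<open>?K t\<close> is minus the pseudoinverse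
    of a real matrix, hence real whatever singular vectors were chosen.\<close>
  have real_K: "real_entries (?K t)" if "z \<in> \<real>"
  proof -
    have "real_entries ?Dz"
      unfolding D_eq using that by (rule real_entries_D_bar)
    then have "real_entries ?M"
      by (intro real_entries_mult real_entries_pinv[OF _ full_row_rank_pinv(1)[OF rank_D]]
          real_entries_cmat)
    then show ?thesis
      unfolding K_tilde_eq by (intro real_entries_minus real_entries_pinv[OF _ pinv_M])
  qed
  have feasI: "K \<in> ?feas" if "rank (?Dz + ?F ** K) < \<rho>" "S = \<real> \<Longrightarrow> real_entries K" for K
    using that scalars by (auto simp: feasible_set_def real_entries_def)
  have necessary: "\<rho> \<ge> N - rank F + 1" if "K \<in> ?feas" for K
  proof -
    \<comment> \<open>Undoing the correction restores rank \<open>N\<close>, while a summand of rank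
      at most \<open>rank F\<close> raises the rank by no more than that.\<close>
    have "?Dz = (?Dz + ?F ** K) + - (?F ** K)"
      by simp
    then have "?Dz = (?Dz + ?F ** K) + ?F ** (- K)"
      by (simp only: matrix_mult_minus_right)
    then have "N \<le> rank (?Dz + ?F ** K) + rank (?F ** (- K))"
      by (metis full_row_rank rank_add_le)
    moreover have "rank (?F ** (- K)) \<le> rank F"
      using rank_mult_le_left[of ?F "- K"] by (simp add: rank_cmat)
    moreover have "rank (?Dz + ?F ** K) < \<rho>"
      using that by (simp add: feasible_set_def)
    ultimately show ?thesis
      by linarith
  qed
  \<comment> \<open>Deflating all \<open>t \<ge> rank F\<close> directions leaves rank at most
    \<open>N - rank F\<close>, below \<open>\<rho>\<close>.\<close>
  have sufficient: "?K t \<in> ?feas" if "N - rank F + 1 \<le> \<rho>" "S = \<real> \<longrightarrow> z \<in> \<real>"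
    using rank_K[of t] rank_F that real_K by (intro feasI) auto
  have optimal_0: "is_optimal_solution S W ?Dz ?F \<rho> 0 \<and> optimal_value S W ?Dz ?F \<rho> = 0" if "N < \<rho>"
  proof -
    have feas: "0 \<in> ?feas"
      using that full_row_rank by (intro feasI) (simp_all add: real_entries_def)
    have obj_0: "objective W (0 :: complex ^ ('n + 'p) ^ ('p + 'l)) = 0"
      and obj: "0 \<le> objective W K" for K :: "complex ^ ('n + 'p) ^ ('p + 'l)"
      by (simp_all add: objective_def spectral_norm_nonneg)
    have "optimal_value S W ?Dz ?F \<rho> \<le> 0"
      unfolding optimal_value_def using feas obj_0 by (intro INF_lower2[of 0]) auto
    moreover have "0 \<le> optimal_value S W ?Dz ?F \<rho>"
      unfolding optimal_value_def using obj by (intro INF_greatest) simp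
    ultimately show ?thesis
      using feas obj_0 obj by (auto simp: is_optimal_solution_def)
  qed
  have K_tilde_feasible: "?K (N - \<rho> + 1) \<in> ?feas"
    if "N - rank F + 1 \<le> \<rho>" "\<rho> \<le> N"
      and real: "S = \<real> \<longrightarrow> z \<in> \<real> \<and> (\<forall>i\<in>{1..CARD('n) + CARD('p)}. \<forall>k. u i $ k \<in> \<real>)
                       \<and> (\<forall>i\<in>{1..CARD('p) + CARD('l)}. \<forall>k. v i $ k \<in> \<real>)"
  proof (rule feasI)
    \<comment> \<open>Removing \<open>N - \<rho> + 1\<close> directions leaves rank at most
      \<open>\<rho> - 1\<close>; as \<open>\<rho> \<le> N\<close>, the subtraction is not
      truncated.\<close>
    have k: "N - \<rho> + 1 \<le> t"
      using that(1,2) rank_F by linarith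
    then show "rank (?Dz + ?F ** ?K (N - \<rho> + 1)) < \<rho>"
      using rank_K[OF k] that(2) by linarith
    show "real_entries (?K (N - \<rho> + 1))" if "S = \<real>"
      using real that k t(3,4) by (intro real_entries_K_tilde) auto
  qed
  have bound: "optimal_value S W ?Dz ?F \<rho> \<le> ereal (spectral_norm W * nuclear_norm (pinv ?M))"
    if "N - rank F + 1 \<le> \<rho>" "S = \<real> \<longrightarrow> z \<in> \<real>"
  proof -
    \<comment> \<open>The test point \<open>?K t\<close> is minus the pseudoinverse whose nuclear
      norm appears in the bound.\<close>
    have "optimal_value S W ?Dz ?F \<rho> \<le> ereal (objective W (?K t))"
      unfolding optimal_value_def by (rule INF_lower[OF sufficient[OF that]])
    also have "objective W (?K t) = spectral_norm (W ** svd_sum t (\<lambda>i. 1 / \<sigma> i) v u)"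
      by (simp add: objective_def K_tilde_eq matrix_mult_minus_right spectral_norm_minus)
    also have "\<dots> \<le> spectral_norm W * spectral_norm (svd_sum t (\<lambda>i. 1 / \<sigma> i) v u)"
      by (rule spectral_norm_mult_le)
    also have "\<dots> \<le> spectral_norm W * nuclear_norm (svd_sum t (\<lambda>i. 1 / \<sigma> i) v u)"
      using t(1,2,5) by (intro mult_left_mono spectral_norm_le_nuclear_norm spectral_norm_nonneg) auto
    finally show ?thesis
      by (simp add: pinv_eqI[OF pinv_M])
  qed
  show ?thesis
    using necessary sufficient optimal_0 K_tilde_feasible bound by blast
qed

end
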